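(* Let $X$ be a real random variable with finite law $\mathbb P(X=x_i)=p_i>0$, $1\le i\le n$, $\sum_{i=1}^n p_i=1$, $n\ge2$, supported on a lattice: $x_i=x_1+(i-1)h$ with $h>0$. If the mass sequence satisfies $$p_i^2\ge p_{i-1}p_{i+1},\qquad 1<i<n,$$ then, with the notation of the context, $(R_i)_{1\le i\le n}$ is strictly decreasing and $(L_i)_{1\le i\le n}$ is strictly increasing. In particular, the probability-coordinate risk profile (the polygon through the points $(P_i,W_i)$, $0\le i\le n$) has strictly increasing consecutive slopes $(W_i-W_{i-1})/p_i$. The optimal cut (the index $i$, $1\le i<n$, minimizing $W_i$) is unique, apart from a possible tie between two adjacent cuts.
   Context: Put $P_i:=\sum_{j\le i}p_j$, $P_0:=0$, and $T_i:=\sum_{j\ge i}p_j$. For $1\le i<n$ the optimized squared risk at the cut after $x_i$ is $$W_i:=\min_{a,b\in\mathbb R}\Big\{\sum_{j\le i}p_j(x_j-a)^2+\sum_{j>i}p_j(x_j-b)^2\Big\},$$ and $W_0=W_n:=\operatorname{Var}(X)$. For $1\le i<n$ set $A_i:=\sum_{j>i}p_j(x_j-x_i)$ and $R_i:=A_i/\sqrt{T_iT_{i+1}}$; for $1<i\le n$ set $C_i:=\sum_{j<i}p_j(x_i-x_j)$ and $L_i:=C_i/\sqrt{P_{i-1}P_i}$; and $L_1:=0$, $R_n:=0$. *)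

theory Defs
  imports "HOL-Probability.Probability"
begin

text \<open>
  The law has atoms \<open>x 1, \<dots>, x n\<close> with masses \<open>p 1, \<dots>, p n\<close>; the values of the functions
  \<open>x\<close> and \<open>p\<close> at other indices are never used.
\<close>

definition cumul :: "(nat \<Rightarrow> real) \<Rightarrow> nat \<Rightarrow> real" where
  "cumul p i = (\<Sum>j\<in>{1..i}. p j)"

definition tail :: "nat \<Rightarrow> (nat \<Rightarrow> real) \<Rightarrow> nat \<Rightarrow> real" where
  "tail n p i = (\<Sum>j\<in>{i..n}. p j)"

definition sq_risk :: "nat \<Rightarrow> (nat \<Rightarrow> real) \<Rightarrow> (nat \<Rightarrow> real) \<Rightarrow> nat \<Rightarrow> real \<Rightarrow> real \<Rightarrow> real" where
  "sq_risk n x p i a b =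
     (\<Sum>j\<in>{1..i}. p j * (x j - a)\<^sup>2) + (\<Sum>j\<in>{i<..n}. p j * (x j - b)\<^sup>2)"

text \<open>
  For positive masses and \<open>1 \<le> i < n\<close> the minimum is attained (at the two conditional means), so
  \<open>LEAST\<close> denotes it.
\<close>

definition cut_risk ::
  "'a measure \<Rightarrow> ('a \<Rightarrow> real) \<Rightarrow> nat \<Rightarrow> (nat \<Rightarrow> real) \<Rightarrow> (nat \<Rightarrow> real) \<Rightarrow> nat \<Rightarrow> real" where
  "cut_risk M X n x p i =
     (if i = 0 \<or> i = n then prob_space.variance M X
      else (LEAST w. \<exists>a b. w = sq_risk n x p i a b))"

definition right_ratio :: "nat \<Rightarrow> (nat \<Rightarrow> real) \<Rightarrow> (nat \<Rightarrow> real) \<Rightarrow> nat \<Rightarrow> real" where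
  "right_ratio n x p i =
     (if i = n then 0
      else (\<Sum>j\<in>{i<..n}. p j * (x j - x i)) / sqrt (tail n p i * tail n p (i + 1)))"

definition left_ratio :: "(nat \<Rightarrow> real) \<Rightarrow> (nat \<Rightarrow> real) \<Rightarrow> nat \<Rightarrow> real" where
  "left_ratio x p i =
     (if i = 1 then 0
      else (\<Sum>j\<in>{1..<i}. p j * (x i - x j)) / sqrt (cumul p (i - 1) * cumul p i))"

text \<open>The vertices of the probability-coordinate risk profile, for \<open>0 \<le> i \<le> n\<close>.\<close>

definition risk_profile ::
  "'a measure \<Rightarrow> ('a \<Rightarrow> real) \<Rightarrow> nat \<Rightarrow> (nat \<Rightarrow> real) \<Rightarrow> (nat \<Rightarrow> real) \<Rightarrow> nat \<Rightarrow> real \<times> real" where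
  "risk_profile M X n x p i = (cumul p i, cut_risk M X n x p i)"

definition segment_slope :: "real \<times> real \<Rightarrow> real \<times> real \<Rightarrow> real" where
  "segment_slope u v = (snd v - snd u) / (fst v - fst u)"

definition optimal_cuts ::
  "'a measure \<Rightarrow> ('a \<Rightarrow> real) \<Rightarrow> nat \<Rightarrow> (nat \<Rightarrow> real) \<Rightarrow> (nat \<Rightarrow> real) \<Rightarrow> nat set" where
  "optimal_cuts M X n x p =
     {i \<in> {1..<n}. \<forall>j\<in>{1..<n}. cut_risk M X n x p i \<le> cut_risk M X n x p j}"

end

theory Submission
  imports Defs
begin

text \<open>
  Splitting off the atom \<open>x i\<close> from either block changes the within-block risk by
  \<open>p i\<close> times a squared ratio, so the \<open>i\<close>-th slope of the profile is
  \<open>(L i)\<^sup>2 - (R i)\<^sup>2\<close>. On a lattice summation by parts turns \<open>L i\<close> into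
  \<open>h * Q (i - 1) / sqrt (P (i - 1) * P i)\<close>, where \<open>P\<close> and \<open>Q\<close> are the first and second
  cumulative sums of the masses. Log-concavity of \<open>p\<close> passes to \<open>P\<close>, and bounding
  \<open>Q\<close> by a geometric series, which is strict because the support is finite, makes \<open>L\<close> strictly
  increasing. Reflecting the lattice gives \<open>R\<close>.
\<close>

lemma strict_mono_on_atLeastAtMost_SucI:
  fixes f :: "nat \<Rightarrow> real"
  assumes "\<And>i. a \<le> i \<Longrightarrow> i < b \<Longrightarrow> f i < f (Suc i)"
  shows "strict_mono_on {a..b} f"
proof (rule strict_mono_onI)
  fix r s assume "r \<in> {a..b}" "s \<in> {a..b}" "r < s"
  then have "Suc r \<le> s" "a \<le> r" "s \<le> b" by auto
  then show "f r < f s"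
  proof (induction s rule: dec_induct)
    case base
    then show ?case using assms[of r] by simp
  next
    case (step m)
    then show ?case using assms[of m] by fastforce
  qed
qed

section \<open>First and second cumulative sums of a log-concave sequence\<close>

lemma cumul_0 [simp]: "cumul p 0 = 0"
  by (simp add: cumul_def)

lemma cumul_Suc [simp]: "cumul p (Suc i) = cumul p i + p (Suc i)"
  by (simp add: cumul_def)

lemma cumul_pos:
  assumes "\<And>j. j \<in> {1..i} \<Longrightarrow> 0 < p j" "1 \<le> i"
  shows "0 < cumul p i"
  unfolding cumul_def using assms by (intro sum_pos) auto

text \<open>This is log-concavity of the cumulative sums in cancelled form: adding
  \<open>cumul p m * cumul p (Suc m)\<close> to both sides gives
  \<open>cumul p m * cumul p (Suc (Suc m))\<close> against the square of
  \<open>cumul p (Suc m)\<close>.\<close>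

lemma cumul_mult_le:
  assumes pos: "\<And>i. i \<in> {1..n} \<Longrightarrow> 0 < p i"
    and lc: "\<And>i. 1 < i \<Longrightarrow> i < n \<Longrightarrow> p (i - 1) * p (i + 1) \<le> (p i)\<^sup>2"
    and "Suc m < n"
  shows "cumul p m * p (Suc (Suc m)) \<le> cumul p (Suc m) * p (Suc m)"
  using \<open>Suc m < n\<close>
proof (induction m)
  case 0
  then show ?case using pos[of 1] by simp
next
  case (Suc m)
  have p: "0 < p (Suc m)" "0 < p (Suc (Suc m))" "0 < p (Suc (Suc (Suc m)))"
    using Suc.prems by (auto intro!: pos)
  have l: "p (Suc m) * p (Suc (Suc (Suc m))) \<le> (p (Suc (Suc m)))\<^sup>2"
    using lc[of "Suc (Suc m)"] Suc.prems by simp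
  have P: "0 < cumul p (Suc m)"
    using Suc.prems by (intro cumul_pos pos) auto
  \<comment> \<open>The induction hypothesis is multiplied by the new mass so that log-concavity of
    \<open>p\<close> applies; the common factor \<open>p (Suc (Suc m))\<close> is cancelled
    afterwards.\<close>
  have "cumul p m * p (Suc (Suc (Suc m))) * p (Suc (Suc m))
      \<le> cumul p (Suc m) * (p (Suc m) * p (Suc (Suc (Suc m))))"
    using mult_right_mono[OF Suc.IH, of "p (Suc (Suc (Suc m)))"] Suc.prems p
    by (simp add: mult_ac)
  also have "\<dots> \<le> cumul p (Suc m) * (p (Suc (Suc m)))\<^sup>2"
    using l P by (intro mult_left_mono) auto
  finally have "cumul p m * p (Suc (Suc (Suc m))) \<le> cumul p (Suc m) * p (Suc (Suc m))"
    using p by (simp add: power2_eq_square mult.assoc [symmetric])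
  then show ?case
    using l by (simp add: algebra_simps power2_eq_square)
qed

text \<open>Put \<open>r = cumul p (Suc m) / cumul p (Suc (Suc m))\<close>. By log-concavity of the
  cumulative sums, the second sum is at most a partial sum of
  \<open>cumul p (Suc m) * (1 + r + r^2 + ...)\<close>, and the full series has value
  \<open>cumul p (Suc m) * cumul p (Suc (Suc m)) / p (Suc (Suc m))\<close>. The induction avoids the
  series; strictness enters in the base case, where the gap is the square of
  \<open>p 1\<close>.\<close>

lemma cumul_cumul_mult_less:
  assumes pos: "\<And>i. i \<in> {1..n} \<Longrightarrow> 0 < p i"
    and lc: "\<And>i. 1 < i \<Longrightarrow> i < n \<Longrightarrow> p (i - 1) * p (i + 1) \<le> (p i)\<^sup>2"
    and "Suc m < n"
  shows "cumul (cumul p) (Suc m) * p (Suc (Suc m)) < cumul p (Suc m) * cumul p (Suc (Suc m))"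
  using \<open>Suc m < n\<close>
proof (induction m)
  case 0
  then show ?case using pos[of 1] by (simp add: algebra_simps)
next
  case (Suc m)
  let ?q = "p (Suc (Suc m))" and ?r = "p (Suc (Suc (Suc m)))"
  let ?b = "cumul p (Suc m)" and ?c = "cumul p (Suc (Suc m))"
  let ?U = "cumul (cumul p) (Suc m)"
  have p: "0 < ?q" "0 < ?r" using Suc.prems by (auto intro!: pos)
  have "0 < ?c" using Suc.prems by (intro cumul_pos pos) auto
  have "?U * ?r * ?q < ?b * ?c * ?r"
    using mult_strict_right_mono[OF Suc.IH, of ?r] Suc.prems p by (simp add: mult_ac)
  also have "\<dots> = ?c * (?b * ?r)" by simp
  also have "\<dots> \<le> ?c * (?c * ?q)"
    using cumul_mult_le[of n p "Suc m", OF pos lc] Suc.prems \<open>0 < ?c\<close>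
    by (intro mult_left_mono) auto
  finally have "?U * ?r * ?q < ?c * ?c * ?q" by (simp add: mult.assoc)
  then have "?U * ?r < ?c * ?c" using p by simp
  then have "(?U + ?c) * ?r < ?c * (?c + ?r)" by (simp add: distrib_left distrib_right)
  then show ?case by (metis cumul_Suc)
qed

section \<open>The left ratio on a lattice\<close>

text \<open>The points \<open>x j\<close> and \<open>x (Suc m)\<close> are \<open>Suc m - j\<close>
  steps apart, and \<open>p j\<close> is a summand of exactly the \<open>Suc m - j\<close> sums
  \<open>cumul p j, ..., cumul p m\<close>.\<close>

lemma sum_lattice_gap:
  fixes h :: real
  assumes "\<And>i. i \<in> {1..n} \<Longrightarrow> x i = x 1 + (real i - 1) * h" and "m < n"
  shows "(\<Sum>j\<in>{1..m}. p j * (x (Suc m) - x j)) = h * cumul (cumul p) m"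
proof -
  have gap: "(\<Sum>j\<in>{1..m}. p j * (real (Suc m) - real j)) = cumul (cumul p) m" for m
  proof (induction m)
    case (Suc m)
    have "(\<Sum>j\<in>{1..m}. p j * (real (Suc (Suc m)) - real j))
        = (\<Sum>j\<in>{1..m}. p j * (real (Suc m) - real j)) + cumul p m"
      unfolding cumul_def sum.distrib [symmetric]
      by (intro sum.cong refl) (simp add: algebra_simps)
    then show ?case using Suc.IH by simp
  qed simp
  have "(\<Sum>j\<in>{1..m}. p j * (x (Suc m) - x j))
      = (\<Sum>j\<in>{1..m}. h * (p j * (real (Suc m) - real j)))"
  proof (intro sum.cong refl)
    fix j assume "j \<in> {1..m}"
    then have "j \<in> {1..n}" "Suc m \<in> {1..n}" using \<open>m < n\<close> by auto
    then have "x (Suc m) - x j = h * (real (Suc m) - real j)"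
      using assms(1)[of j] assms(1)[of "Suc m"] by (simp add: algebra_simps)
    then show "p j * (x (Suc m) - x j) = h * (p j * (real (Suc m) - real j))"
      by simp
  qed
  also have "\<dots> = h * cumul (cumul p) m"
    unfolding sum_distrib_left [symmetric] gap ..
  finally show ?thesis .
qed

text \<open>Needed to pass from monotone ratios to monotone squares in the slope formula.\<close>

lemma left_ratio_nonneg:
  fixes h :: real
  assumes pos: "\<And>i. i \<in> {1..n} \<Longrightarrow> 0 < p i" and "0 < h"
    and lat: "\<And>i. i \<in> {1..n} \<Longrightarrow> x i = x 1 + (real i - 1) * h"
    and i: "i \<in> {1..n}"
  shows "0 \<le> left_ratio x p i"
proof -
  have "0 \<le> p j * (x i - x j)" if "j \<in> {1..<i}" for j
    using that i pos[of j] lat[of i] lat[of j] \<open>0 < h\<close>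
    by (auto intro!: mult_nonneg_nonneg mult_right_mono)
  moreover have "0 \<le> cumul p j" if "j \<le> i" for j
    unfolding cumul_def using that i by (intro sum_nonneg less_imp_le pos) auto
  ultimately show ?thesis
    unfolding left_ratio_def by (auto intro!: divide_nonneg_nonneg sum_nonneg)
qed

lemma strict_mono_on_left_ratio:
  fixes h :: real
  assumes pos: "\<And>i. i \<in> {1..n} \<Longrightarrow> 0 < p i"
    and lc: "\<And>i. 1 < i \<Longrightarrow> i < n \<Longrightarrow> p (i - 1) * p (i + 1) \<le> (p i)\<^sup>2"
    and "0 < h"
    and lat: "\<And>i. i \<in> {1..n} \<Longrightarrow> x i = x 1 + (real i - 1) * h"
  shows "strict_mono_on {1..n} (left_ratio x p)"
proof (rule strict_mono_on_atLeastAtMost_SucI)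
  \<comment> \<open>The formula covers \<open>m = 0\<close> too: its numerator is 0, in agreement
    with the default value of \<open>left_ratio\<close> at 1.\<close>
  have eq: "left_ratio x p (Suc m) = h * cumul (cumul p) m / sqrt (cumul p m * cumul p (Suc m))"
    if "m < n" for m
    using sum_lattice_gap[of n x h m p, OF lat that]
    by (simp add: left_ratio_def atLeastLessThanSuc_atLeastAtMost)
  fix i assume i: "1 \<le> i" "i < n"
  have P: "0 < cumul p j" if "1 \<le> j" "j \<le> n" for j
    using that by (intro cumul_pos pos) auto
  have Q: "0 < cumul (cumul p) j" if "1 \<le> j" "j \<le> n" for j
    using that by (intro cumul_pos P) auto
  show "left_ratio x p i < left_ratio x p (Suc i)"
  proof (cases "i = 1")
    \<comment> \<open>The first atom is separate because the general argument cancels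
      \<open>cumul p (i - 1)\<close>, which is 0 here.\<close>
    case True
    have "0 < left_ratio x p (Suc i)"
      using eq[of i] i \<open>0 < h\<close> P[of i] P[of "Suc i"] Q[of i]
      by (simp del: cumul_Suc)
    then show ?thesis using True by (simp add: left_ratio_def)
  next
    case False
    then obtain m where m: "i = Suc (Suc m)" using i by (metis One_nat_def not0_implies_Suc not_one_le_zero)
    let ?k = "Suc m"
    let ?U = "cumul (cumul p) ?k" and ?a = "cumul p ?k" and ?b = "cumul p (Suc ?k)"
      and ?c = "cumul p (Suc (Suc ?k))"
    have *: "0 < ?U" "0 < ?a" "0 < ?b" "0 < ?c"
      using i m by (auto intro!: P Q simp del: cumul_Suc)
    \<comment> \<open>Since \<open>?b - ?a\<close> is the mass \<open>p (Suc ?k)\<close>, this is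
      the geometric bound. It says \<open>(?U + ?b) / ?U > ?b / ?a\<close>; squaring and using
      \<open>?b^2 / ?a^2 \<ge> ?c / ?a\<close> gives \<open>key\<close>, the comparison of the
      squared ratios.\<close>
    have "?U * (?b - ?a) < ?a * ?b"
      using cumul_cumul_mult_less[of n p m, OF pos lc] i m by simp
    then have "?U * ?b < ?a * (?U + ?b)" by (simp add: algebra_simps)
    then have "(?U * ?b)\<^sup>2 < (?a * (?U + ?b))\<^sup>2"
      using * by (intro power_strict_mono) auto
    moreover have "?a * ?c \<le> ?b\<^sup>2"
      using cumul_mult_le[of n p ?k, OF pos lc] i m by (simp add: algebra_simps power2_eq_square)
    then have "?U\<^sup>2 * (?a * ?c) \<le> ?U\<^sup>2 * ?b\<^sup>2" by (intro mult_left_mono) auto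
    ultimately have "?a * (?U\<^sup>2 * ?c) < ?a * ((?U + ?b)\<^sup>2 * ?a)"
      by (simp add: power_mult_distrib power2_eq_square mult_ac)
    then have key: "?U\<^sup>2 * ?c < (?U + ?b)\<^sup>2 * ?a" using * by simp
    have "?U\<^sup>2 / (?a * ?b) < (?U + ?b)\<^sup>2 / (?b * ?c)"
    proof -
      have "?U\<^sup>2 * ?c / (?a * ?b * ?c) < (?U + ?b)\<^sup>2 * ?a / (?a * ?b * ?c)"
        using key * by (intro divide_strict_right_mono) auto
      then show ?thesis using * by (simp add: mult_ac)
    qed
    then have "sqrt (?U\<^sup>2 / (?a * ?b)) < sqrt ((?U + ?b)\<^sup>2 / (?b * ?c))" by simp
    then have "?U / sqrt (?a * ?b) < (?U + ?b) / sqrt (?b * ?c)"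
      using * by (simp add: real_sqrt_divide del: cumul_Suc)
    then have "h * (?U / sqrt (?a * ?b)) < h * (cumul (cumul p) (Suc ?k) / sqrt (?b * ?c))"
      using \<open>0 < h\<close> by (metis cumul_Suc mult_strict_left_mono)
    then show ?thesis using eq[of ?k] eq[of "Suc ?k"] i m by (simp del: cumul_Suc)
  qed
qed

section \<open>The right ratio by reflection\<close>

text \<open>Reversing the indices turns tails into cumulative sums, and negating the points restores
  the sign of the gaps. The default value at \<open>i = n\<close> corresponds to the one of
  \<open>left_ratio\<close> at 1.\<close>

lemma right_ratio_eq_left_ratio_reflect:
  assumes "i \<in> {1..n}"
  shows "right_ratio n x p i
    = left_ratio (\<lambda>j. - x (n + 1 - j)) (\<lambda>j. p (n + 1 - j)) (n + 1 - i)"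
proof -
  have sum: "(\<Sum>j\<in>{i<..n}. p j * (x j - x i))
      = (\<Sum>j\<in>{1..<n + 1 - i}. p (n + 1 - j) * (- x (n + 1 - (n + 1 - i)) - - x (n + 1 - j)))"
    using assms
    by (intro sum.reindex_bij_witness[of _ "\<lambda>j. n + 1 - j" "\<lambda>j. n + 1 - j"]) auto
  have tail: "tail n p k = cumul (\<lambda>j. p (n + 1 - j)) (n + 1 - k)" if "1 \<le> k" for k
    unfolding tail_def cumul_def using that
    by (intro sum.reindex_bij_witness[of _ "\<lambda>j. n + 1 - j" "\<lambda>j. n + 1 - j"]) auto
  show ?thesis
    using assms tail[of i] tail[of "i + 1"]
    unfolding right_ratio_def left_ratio_def sum by (auto simp: mult.commute)
qed

lemma right_ratio_lattice:
  fixes h :: real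
  assumes pos: "\<And>i. i \<in> {1..n} \<Longrightarrow> 0 < p i"
    and lc: "\<And>i. 1 < i \<Longrightarrow> i < n \<Longrightarrow> p (i - 1) * p (i + 1) \<le> (p i)\<^sup>2"
    and "0 < h"
    and lat: "\<And>i. i \<in> {1..n} \<Longrightarrow> x i = x 1 + (real i - 1) * h"
  shows strict_antimono_on_right_ratio: "strict_antimono_on {1..n} (right_ratio n x p)"
    and right_ratio_nonneg: "\<And>i. i \<in> {1..n} \<Longrightarrow> 0 \<le> right_ratio n x p i"
proof -
  define y where "y = (\<lambda>j. - x (n + 1 - j))"
  define q where "q = (\<lambda>j. p (n + 1 - j))"
  have R: "right_ratio n x p i = left_ratio y q (n + 1 - i)" if "i \<in> {1..n}" for i
    unfolding y_def q_def by (rule right_ratio_eq_left_ratio_reflect[OF that])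
  have q: "0 < q i" if "i \<in> {1..n}" for i
    using that unfolding q_def by (intro pos) auto
  have qlc: "q (i - 1) * q (i + 1) \<le> (q i)\<^sup>2" if "1 < i" "i < n" for i
  proof -
    have "n + 1 - (i - 1) = n + 1 - i + 1" "n + 1 - (i + 1) = n + 1 - i - 1"
      "1 < n + 1 - i" "n + 1 - i < n" using that by auto
    then show ?thesis unfolding q_def using lc[of "n + 1 - i"] by (metis mult.commute)
  qed
  \<comment> \<open>Negation compensates the reversal, so the step is again \<open>h\<close> rather
    than \<open>- h\<close>.\<close>
  have ylat: "y i = y 1 + (real i - 1) * h" if "i \<in> {1..n}" for i
  proof -
    have "x (n + 1 - i) = x 1 + (real (n + 1 - i) - 1) * h" "x n = x 1 + (real n - 1) * h"
      using that by (intro lat; fastforce)+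
    then show ?thesis unfolding y_def using that by (simp add: of_nat_diff algebra_simps)
  qed
  have L: "strict_mono_on {1..n} (left_ratio y q)"
    using q qlc \<open>0 < h\<close> ylat by (rule strict_mono_on_left_ratio)
  show "strict_antimono_on {1..n} (right_ratio n x p)"
  proof (rule monotone_onI)
    fix i j assume "i \<in> {1..n}" "j \<in> {1..n}" "i < j"
    then show "right_ratio n x p j < right_ratio n x p i"
      by (auto simp: R intro!: strict_mono_onD[OF L])
  qed
  show "0 \<le> right_ratio n x p i" if "i \<in> {1..n}" for i
    unfolding R[OF that] using that
    by (intro left_ratio_nonneg[OF q \<open>0 < h\<close> ylat]) auto
qed

section \<open>Within-block risk and the optimized risk of a cut\<close>

text \<open>Gives \<open>0\<close> on the empty block, by \<open>0 / 0 = 0\<close>.\<close>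

definition block_risk :: "(nat \<Rightarrow> real) \<Rightarrow> (nat \<Rightarrow> real) \<Rightarrow> nat set \<Rightarrow> real" where
  "block_risk x p A = (\<Sum>j\<in>A. p j * (x j)\<^sup>2) - (\<Sum>j\<in>A. p j * x j)\<^sup>2 / (\<Sum>j\<in>A. p j)"

lemma sum_sq_dev_expand:
  fixes p x :: "nat \<Rightarrow> real"
  shows "(\<Sum>j\<in>A. p j * (x j - a)\<^sup>2)
    = (\<Sum>j\<in>A. p j * (x j)\<^sup>2) - 2 * a * (\<Sum>j\<in>A. p j * x j) + a\<^sup>2 * (\<Sum>j\<in>A. p j)"
  by (simp add: sum_distrib_left sum_subtractf [symmetric] sum.distrib [symmetric]
      power2_eq_square algebra_simps)

text \<open>Completing the square in \<open>a\<close>. For positive total mass,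
  \<open>block_risk\<close> is therefore the minimum over \<open>a\<close>, attained at the block
  mean.\<close>

lemma sum_sq_dev_eq_block_risk:
  assumes "sum p A \<noteq> 0"
  shows "(\<Sum>j\<in>A. p j * (x j - a)\<^sup>2)
    = block_risk x p A + sum p A * (a - (\<Sum>j\<in>A. p j * x j) / sum p A)\<^sup>2"
  unfolding sum_sq_dev_expand block_risk_def using assms
  by (simp add: field_simps power2_eq_square)

text \<open>The increment is the between-group risk of the atom and the block: the inner sum is
  \<open>sum p A\<close> times the distance from \<open>x k\<close> to the mean of \<open>A\<close>.
  For empty \<open>A\<close> it is 0 by division by zero, which fits the zero ratios at the extreme
  atoms.\<close>

lemma block_risk_insert:
  assumes "finite A" "k \<notin> A" "\<And>j. j \<in> insert k A \<Longrightarrow> 0 < p j"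
  shows "block_risk x p (insert k A) = block_risk x p A
    + p k * (\<Sum>j\<in>A. p j * (x k - x j))\<^sup>2 / (sum p A * sum p (insert k A))"
proof (cases "A = {}")
  case True
  then show ?thesis using assms by (simp add: block_risk_def power2_eq_square)
next
  case False
  have *: "0 < sum p A" "0 < p k"
    using assms False by (auto intro!: sum_pos)
  have dev: "(\<Sum>j\<in>A. p j * (x k - x j)) = x k * sum p A - (\<Sum>j\<in>A. p j * x j)"
    by (simp add: algebra_simps sum_subtractf sum_distrib_left)
  have alg: "q * z\<^sup>2 + S2 - (q * z + S1)\<^sup>2 / (q + s)
      = S2 - S1\<^sup>2 / s + q * (z * s - S1)\<^sup>2 / (s * (q + s))"
    if "0 < s" "0 < q" for q z S1 S2 s :: real
  proof -
    have "q + s \<noteq> 0" "s \<noteq> 0" using that by auto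
    then show ?thesis by (simp add: divide_simps) (simp add: algebra_simps power2_eq_square)
  qed
  show ?thesis
    unfolding dev block_risk_def using assms(1,2) alg[OF *, of "x k"] by simp
qed

lemma Least_sq_risk:
  assumes pos: "\<And>j. j \<in> {1..n} \<Longrightarrow> 0 < p j" and i: "1 \<le> i" "i < n"
  shows "(LEAST w. \<exists>a b. w = sq_risk n x p i a b)
    = block_risk x p {1..i} + block_risk x p {i<..n}"
proof -
  have s: "0 < sum p {1..i}" "0 < sum p {i<..n}"
    using i by (auto intro!: sum_pos pos)
  have eq: "sq_risk n x p i a b = block_risk x p {1..i} + block_risk x p {i<..n}
      + sum p {1..i} * (a - (\<Sum>j\<in>{1..i}. p j * x j) / sum p {1..i})\<^sup>2
      + sum p {i<..n} * (b - (\<Sum>j\<in>{i<..n}. p j * x j) / sum p {i<..n})\<^sup>2" for a b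
    unfolding sq_risk_def using s by (subst (1 2) sum_sq_dev_eq_block_risk) auto
  show ?thesis
  proof (rule Least_equality)
    have "block_risk x p {1..i} + block_risk x p {i<..n}
      = sq_risk n x p i ((\<Sum>j\<in>{1..i}. p j * x j) / sum p {1..i})
          ((\<Sum>j\<in>{i<..n}. p j * x j) / sum p {i<..n})"
      unfolding eq by simp
    then show "\<exists>a b. block_risk x p {1..i} + block_risk x p {i<..n} = sq_risk n x p i a b"
      by blast
  next
    fix w assume "\<exists>a b. w = sq_risk n x p i a b"
    then obtain a b where w: "w = sq_risk n x p i a b" by blast
    show "block_risk x p {1..i} + block_risk x p {i<..n} \<le> w"
      unfolding w eq using s by simp
  qed
qed

section \<open>Expectations under a finite law\<close>

text \<open>The events \<open>X = x i\<close> are disjoint with total probability 1, so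
  \<open>f (X \<omega>)\<close> agrees almost everywhere with a simple function.\<close>

lemma (in prob_space) expectation_finite_law:
  fixes X :: "'a \<Rightarrow> real" and f :: "real \<Rightarrow> real"
  assumes X [measurable]: "X \<in> borel_measurable M"
    and f [measurable]: "f \<in> borel_measurable borel"
    and law: "\<And>i. i \<in> I \<Longrightarrow> prob {\<omega> \<in> space M. X \<omega> = x i} = p i"
    and "finite I" and one: "sum p I = 1" and inj: "inj_on x I"
  shows "expectation (\<lambda>\<omega>. f (X \<omega>)) = (\<Sum>i\<in>I. p i * f (x i))"
proof -
  define E where "E i = {\<omega> \<in> space M. X \<omega> = x i}" for i
  have E [measurable]: "E i \<in> sets M" for i unfolding E_def by measurable
  have disj: "disjoint_family_on E I"
    using inj by (auto simp: disjoint_family_on_def E_def dest: inj_onD)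
  have "prob (\<Union>i\<in>I. E i) = (\<Sum>i\<in>I. prob (E i))"
    using disj \<open>finite I\<close> by (intro finite_measure_finite_Union) auto
  also have "\<dots> = 1" using law one by (simp add: E_def)
  finally have ae: "AE \<omega> in M. \<omega> \<in> (\<Union>i\<in>I. E i)"
    using \<open>finite I\<close> by (subst (asm) prob_eq_1) auto
  have eq: "f (X \<omega>) = (\<Sum>i\<in>I. f (x i) * indicator (E i) \<omega>)" if "\<omega> \<in> (\<Union>i\<in>I. E i)" for \<omega>
  proof -
    from that obtain k where k: "k \<in> I" "\<omega> \<in> E k" by blast
    have "(\<Sum>i\<in>I. f (x i) * indicator (E i) \<omega>) = (\<Sum>i\<in>I. if i = k then f (x i) else 0)"
      using k inj by (intro sum.cong refl) (auto simp: E_def indicator_def dest: inj_onD)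
    then show ?thesis using k \<open>finite I\<close> by (simp add: E_def)
  qed
  have f': "AE \<omega> in M. f (X \<omega>) = (\<Sum>i\<in>I. f (x i) * indicator (E i) \<omega>)"
    using ae by eventually_elim (rule eq)
  have "has_bochner_integral M (\<lambda>\<omega>. \<Sum>i\<in>I. f (x i) * indicator (E i) \<omega>) (\<Sum>i\<in>I. f (x i) * p i)"
  proof (intro has_bochner_integral_sum has_bochner_integral_mult_right)
    fix i assume "i \<in> I"
    then show "has_bochner_integral M (indicator (E i) :: 'a \<Rightarrow> real) (p i)"
      using has_bochner_integral_real_indicator[OF E[of i]] law[of i]
      by (simp add: E_def emeasure_eq_measure)
  qed
  then have int: "(\<integral>\<omega>. (\<Sum>i\<in>I. f (x i) * indicator (E i) \<omega>) \<partial>M) = (\<Sum>i\<in>I. f (x i) * p i)"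
    by (rule has_bochner_integral_integral_eq)
  have "(\<integral>\<omega>. f (X \<omega>) \<partial>M) = (\<integral>\<omega>. (\<Sum>i\<in>I. f (x i) * indicator (E i) \<omega>) \<partial>M)"
    using f' by (intro integral_cong_AE) auto
  then show ?thesis using int by (simp add: mult.commute)
qed

section \<open>Minimizers of a sequence with increasing slopes\<close>

text \<open>Two minimizers at distance at least 2 are impossible: the slope leaving the first is
  nonnegative, so the later slope entering the second is positive, and the predecessor of the second
  has a smaller value.\<close>

lemma slope_strict_mono_argmin:
  fixes W q :: "nat \<Rightarrow> real"
  assumes "n \<ge> 2" and q: "\<And>i. i \<in> {1..n} \<Longrightarrow> 0 < q i"
    and mono: "strict_mono_on {1..n} (\<lambda>i. (W i - W (i - 1)) / q i)"
  shows "\<exists>k. {i \<in> {1..<n}. \<forall>j\<in>{1..<n}. W i \<le> W j} \<in> {{k}, {k, k + 1}}"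
proof -
  define S where "S = {i \<in> {1..<n}. \<forall>j\<in>{1..<n}. W i \<le> W j}"
  have "W (arg_min_on W {1..<n}) \<le> W j" if "j \<in> {1..<n}" for j
    using that by (intro arg_min_least) auto
  moreover have "arg_min_on W {1..<n} \<in> {1..<n}"
    using \<open>n \<ge> 2\<close> by (intro arg_min_if_finite) auto
  ultimately have "arg_min_on W {1..<n} \<in> S" unfolding S_def by blast
  define k where "k = (LEAST i. i \<in> S)"
  have k: "k \<in> S" unfolding k_def using \<open>arg_min_on W {1..<n} \<in> S\<close> by (rule LeastI)
  have "j \<in> {k, k + 1}" if j: "j \<in> S" for j
  proof (rule ccontr)
    assume "j \<notin> {k, k + 1}"
    moreover have "k \<le> j" unfolding k_def using j by (rule Least_le)
    ultimately have "k + 2 \<le> j" by auto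
    have "0 \<le> (W (k + 1) - W (k + 1 - 1)) / q (k + 1)"
      using k j \<open>k + 2 \<le> j\<close> q[of "k + 1"] by (auto simp: S_def intro!: divide_nonneg_pos)
    also have "\<dots> < (W j - W (j - 1)) / q j"
      using j k \<open>k + 2 \<le> j\<close> by (intro strict_mono_onD[OF mono]) (auto simp: S_def)
    finally have "W (j - 1) < W j"
      using q[of j] j by (auto simp: S_def zero_less_divide_iff)
    moreover have "j - 1 \<in> {1..<n}" using j k \<open>k + 2 \<le> j\<close> by (auto simp: S_def)
    then have "W j \<le> W (j - 1)" using j by (simp add: S_def)
    ultimately show False by simp
  qed
  then have "S = {k} \<or> S = {k, k + 1}" using k by blast
  then show ?thesis unfolding S_def by blast
qed

section \<open>Slopes of the risk profile and optimal cuts\<close>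

theorem corollary3p2:
  fixes M :: "'a measure" and X :: "'a \<Rightarrow> real"
    and n :: nat and x p :: "nat \<Rightarrow> real" and h :: real
  assumes "prob_space M"
    and "X \<in> borel_measurable M"
    and "n \<ge> 2"
    and "\<And>i. i \<in> {1..n} \<Longrightarrow> measure M {\<omega> \<in> space M. X \<omega> = x i} = p i"
    and "\<And>i. i \<in> {1..n} \<Longrightarrow> p i > 0"
    and "(\<Sum>i\<in>{1..n}. p i) = 1"
    and "h > 0"
    and "\<And>i. i \<in> {1..n} \<Longrightarrow> x i = x 1 + (real i - 1) * h"
    and "\<And>i. 1 < i \<Longrightarrow> i < n \<Longrightarrow> (p i)\<^sup>2 \<ge> p (i - 1) * p (i + 1)"
  shows "strict_antimono_on {1..n} (right_ratio n x p)
    \<and> strict_mono_on {1..n} (left_ratio x p)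
    \<and> (\<forall>i\<in>{1..n}. segment_slope (risk_profile M X n x p (i - 1)) (risk_profile M X n x p i)
          = (cut_risk M X n x p i - cut_risk M X n x p (i - 1)) / p i)
    \<and> strict_mono_on {1..n} (\<lambda>i. (cut_risk M X n x p i - cut_risk M X n x p (i - 1)) / p i)
    \<and> (\<exists>k. optimal_cuts M X n x p = {k} \<or> optimal_cuts M X n x p = {k, k + 1})"
proof -
  interpret prob_space M by (rule assms(1))
  note pos = assms(5) and lat = assms(8) and lc = assms(9)
  let ?W = "cut_risk M X n x p"
  have R: "strict_antimono_on {1..n} (right_ratio n x p)"
    using pos lc \<open>h > 0\<close> lat by (rule strict_antimono_on_right_ratio)
  have L: "strict_mono_on {1..n} (left_ratio x p)"
    using pos lc \<open>h > 0\<close> lat by (rule strict_mono_on_left_ratio)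
  have R0: "0 \<le> right_ratio n x p i" if "i \<in> {1..n}" for i
    using pos lc \<open>h > 0\<close> lat that by (rule right_ratio_nonneg)
  have L0: "0 \<le> left_ratio x p i" if "i \<in> {1..n}" for i
    using pos \<open>h > 0\<close> lat that by (rule left_ratio_nonneg)

  have inj: "inj_on x {1..n}"
  proof (rule inj_onI)
    fix i j assume "i \<in> {1..n}" "j \<in> {1..n}" "x i = x j"
    then show "i = j" using lat[of i] lat[of j] \<open>h > 0\<close> by simp
  qed
  have E: "expectation (\<lambda>\<omega>. f (X \<omega>)) = (\<Sum>i\<in>{1..n}. p i * f (x i))"
    if "f \<in> borel_measurable borel" for f :: "real \<Rightarrow> real"
    using assms(2) that assms(4) finite_atLeastAtMost assms(6) inj
    by (rule expectation_finite_law)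
  \<comment> \<open>As the total mass is 1, \<open>expectation X\<close> is the mean of the full
    block, so the completed square vanishes.\<close>
  have "variance X = block_risk x p {1..n}"
    using E[of "\<lambda>y. y"] E[of "\<lambda>y. (y - expectation X)\<^sup>2"]
      sum_sq_dev_eq_block_risk[of p "{1..n}" x "expectation X"] assms(6) by simp
  \<comment> \<open>At \<open>i = 0\<close> and \<open>i = n\<close> one block is empty and has risk
    0, so the variance fits the two-block formula.\<close>
  then have W: "?W i = block_risk x p {1..i} + block_risk x p {i<..n}" if "i \<le> n" for i
    using that Least_sq_risk[of n p i x, OF pos]
    by (auto simp: cut_risk_def block_risk_def [of _ _ "{}"]
        atLeastSucAtMost_greaterThanAtMost [symmetric])

  \<comment> \<open>Moving the cut past \<open>x i\<close> takes this atom out of the right block,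
    at a gain of \<open>p i\<close> times the squared right ratio, and puts it into the left block,
    at a cost of \<open>p i\<close> times the squared left ratio.\<close>
  have step: "?W i - ?W (i - 1) = p i * ((left_ratio x p i)\<^sup>2 - (right_ratio n x p i)\<^sup>2)"
    if i: "i \<in> {1..n}" for i
  proof -
    have sets: "insert i {1..<i} = {1..i}" "{1..i - 1} = {1..<i}"
      "insert i {i<..n} = {i..n}" "{i - 1<..n} = {i..n}" "{i + 1..n} = {i<..n}"
      using i by auto
    \<comment> \<open>These signs let the squared square roots in the ratios simplify to the
      products of masses.\<close>
    have nn: "0 \<le> sum p {1..<i}" "0 \<le> sum p {1..i}" "0 \<le> sum p {i<..n}" "0 \<le> sum p {i..n}"
      using i by (intro sum_nonneg less_imp_le pos; simp)+
    have l: "block_risk x p {1..i} = block_risk x p {1..<i} + p i * (left_ratio x p i)\<^sup>2"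
      using block_risk_insert[of "{1..<i}" i p x] i pos nn
      unfolding sets left_ratio_def cumul_def by (auto simp: power_divide)
    have r: "block_risk x p {i..n} = block_risk x p {i<..n} + p i * (right_ratio n x p i)\<^sup>2"
    proof -
      have "(\<Sum>j\<in>{i<..n}. p j * (x i - x j))\<^sup>2 = (\<Sum>j\<in>{i<..n}. p j * (x j - x i))\<^sup>2"
        by (subst power2_minus [symmetric]) (simp add: sum_negf [symmetric] algebra_simps)
      then show ?thesis
        using block_risk_insert[of "{i<..n}" i p x] i pos nn
        unfolding sets right_ratio_def tail_def by (auto simp: power_divide mult.commute)
    qed
    have "i \<le> n" "i - 1 \<le> n" using i by auto
    then show ?thesis
      using W[of i] W[of "i - 1"] l r unfolding sets by (simp add: algebra_simps)
  qed
  have slope: "(?W i - ?W (i - 1)) / p i = (left_ratio x p i)\<^sup>2 - (right_ratio n x p i)\<^sup>2"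
    if "i \<in> {1..n}" for i
    using step[OF that] pos[OF that] by simp
  have mono: "strict_mono_on {1..n} (\<lambda>i. (?W i - ?W (i - 1)) / p i)"
  proof (rule strict_mono_onI)
    fix i j assume ij: "i \<in> {1..n}" "j \<in> {1..n}" "i < j"
    have "(left_ratio x p i)\<^sup>2 < (left_ratio x p j)\<^sup>2"
      using ij L0 strict_mono_onD[OF L] by (intro power_strict_mono) auto
    moreover have "(right_ratio n x p j)\<^sup>2 < (right_ratio n x p i)\<^sup>2"
      using ij R0 monotone_onD[OF R] by (intro power_strict_mono) auto
    ultimately show "(?W i - ?W (i - 1)) / p i < (?W j - ?W (j - 1)) / p j"
      using slope ij by simp
  qed
  have seg: "segment_slope (risk_profile M X n x p (i - 1)) (risk_profile M X n x p i)
      = (?W i - ?W (i - 1)) / p i" if "i \<in> {1..n}" for i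
  proof -
    have "cumul p i - cumul p (i - 1) = p i" using that by (cases i) auto
    then show ?thesis by (simp add: segment_slope_def risk_profile_def)
  qed
  have "\<exists>k. optimal_cuts M X n x p = {k} \<or> optimal_cuts M X n x p = {k, k + 1}"
    using slope_strict_mono_argmin[OF \<open>n \<ge> 2\<close> pos mono] unfolding optimal_cuts_def by auto
  then show ?thesis using R L seg mono by blast
qed

end
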